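(* There is a one-to-one correspondence between skeletal $2$-term averaging $L_\infty$-algebras and triples of the form $(\mathfrak{g}_P, V_Q, (f,\theta))$, where $\mathfrak{g}_P$ is an averaging Lie algebra, $V_Q$ is a representation of $\mathfrak{g}_P$, and $(f,\theta)\in C^3_{\mathrm{ALie}}(\mathfrak{g}_P,V_Q)$ is a $3$-cocycle.
   Context: Everything is over a field $\mathbf{k}$ of characteristic zero. An averaging operator on a Lie algebra $\mathfrak{g}$ is a linear map $P:\mathfrak{g}\to\mathfrak{g}$ with $[P(x),P(y)]_{\mathfrak{g}}=P([P(x),y]_{\mathfrak{g}})$ for all $x,y$. An averaging Lie algebra $\mathfrak{g}_P$ is a Lie algebra $\mathfrak{g}$ with an averaging operator $P$. A representation $V_Q$ of $\mathfrak{g}_P$ is a Lie algebra representation $\psi:\mathfrak{g}\to\mathrm{End}(V)$ with a linear map $Q:V\to V$ such that $\psi_{P(x)}Q(v)=Q(\psi_{P(x)}v)=Q(\psi_xQ(v))$ for all $x\in\mathfrak{g}$, $v\in V$. Cohomology: $C^0_{\mathrm{ALie}}(\mathfrak{g}_P,V_Q)=0$, $C^1_{\mathrm{ALie}}(\mathfrak{g}_P,V_Q)=\mathrm{Hom}(\mathfrak{g},V)$, and $C^n_{\mathrm{ALie}}(\mathfrak{g}_P,V_Q)=\mathrm{Hom}(\wedge^n\mathfrak{g},V)\oplus\mathrm{Hom}(\mathfrak{g}^{\otimes n-1},V)$ for $n\ge2$, with coboundary $$\delta^n_{\mathrm{ALie}}((f,\theta))=\big(\delta^n_{\mathrm{Lie}}(f),\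 \partial^{n-1}_{\mathrm{Leib}}(\theta)+(-1)^nf\circ P^{\otimes n}-(-1)^nQf\circ(P^{\otimes n-1}\otimes\mathrm{Id})\big)$$ (for $n=1$ the $\theta$-terms are absent). Here $\delta_{\mathrm{Lie}}$ is the Chevalley-Eilenberg coboundary of $\mathfrak{g}$ with coefficients in $(V,\psi)$, and $$\partial^{n-1}_{\mathrm{Leib}}(\theta)(x_1,\dots,x_n)=\sum_{i=1}^{n-1}(-1)^{i+1}\psi_{P(x_i)}\theta(x_1,\dots,\widehat{x_i},\dots,x_n)+(-1)^{n+1}\psi_{P(x_n)}\theta(x_1,\dots,x_{n-1})+(-1)^nQ(\psi_{x_n}\theta(x_1,\dots,x_{n-1}))+\sum_{1\le i<j\le n}(-1)^i\theta(x_1,\dots,\widehat{x_i},\dots,x_{j-1},[P(x_i),x_j]_{\mathfrak{g}},\dots,x_n).$$ An $n$-cocycle is an element of $\ker\delta^n_{\mathrm{ALie}}$. A $2$-term $L_\infty$-algebra $(\mathfrak{g}_1\xrightarrow{d}\mathfrak{g}_0,\llbracket\,,\,\rrbracket,l_3)$ consists of a $2$-term chain complex, i.e. a linear map $d:\mathfrak{g}_1\to\mathfrak{g}_0$, bilinear maps $\llbracket\,,\,\rrbracket:\mathfrak{g}_i\times\mathfrak{g}_j\to\mathfrak{g}_{i+j}$ ($0\le i,j\le1$, with $\mathfrak{g}_2=0$) and a skew-symmetric trilinear map $l_3:\mathfrak{g}_0\times\mathfrak{g}_0\times\mathfrak{g}_0\to\mathfrak{g}_1$ such that for all $w,x,y,z\in\mathfrak{g}_0$,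 $h,k\in\mathfrak{g}_1$: (L1) $\llbracket x,y\rrbracket=-\llbracket y,x\rrbracket$; (L2) $\llbracket x,h\rrbracket=-\llbracket h,x\rrbracket$; (L3) $\llbracket h,k\rrbracket=0$; (L4) $d\llbracket x,h\rrbracket=\llbracket x,dh\rrbracket$; (L5) $\llbracket dh,k\rrbracket=\llbracket h,dk\rrbracket$; (L6) $d(l_3(x,y,z))=\llbracket x,\llbracket y,z\rrbracket\rrbracket+\llbracket y,\llbracket z,x\rrbracket\rrbracket+\llbracket z,\llbracket x,y\rrbracket\rrbracket$; (L7) $l_3(x,y,dh)=\llbracket x,\llbracket y,h\rrbracket\rrbracket+\llbracket y,\llbracket h,x\rrbracket\rrbracket+\llbracket h,\llbracket x,y\rrbracket\rrbracket$; (L8) $\llbracket w,l_3(x,y,z)\rrbracket-\llbracket x,l_3(w,y,z)\rrbracket+\llbracket y,l_3(w,x,z)\rrbracket-\llbracket z,l_3(w,x,y)\rrbracket=l_3(\llbracket w,x\rrbracket,y,z)-l_3(\llbracket w,y\rrbracket,x,z)+l_3(\llbracket w,z\rrbracket,x,y)+l_3(\llbracket x,y\rrbracket,w,z)-l_3(\llbracket x,z\rrbracket,w,y)+l_3(\llbracket y,z\rrbracket,w,x)$. A homotopy averaging operator on it is a triple $(P_0,P_1,P_2)$ of linear maps $P_0:\mathfrak{g}_0\to\mathfrak{g}_0$, $P_1:\mathfrak{g}_1\to\mathfrak{g}_1$ and a skew-symmetric bilinear map $P_2:\mathfrak{g}_0\times\mathfrak{g}_0\to\mathfrak{g}_1$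 such that for all $x,y,z\in\mathfrak{g}_0$, $h\in\mathfrak{g}_1$: (A1) $P_0\circ d=d\circ P_1$; (A2) $d(P_2(x,y))=P_0(\llbracket P_0(x),y\rrbracket)-\llbracket P_0(x),P_0(y)\rrbracket$; (A3) $P_2(x,dh)=P_1(\llbracket P_0(x),h\rrbracket)-\llbracket P_0(x),P_1(h)\rrbracket=P_1(\llbracket x,P_1(h)\rrbracket)-\llbracket P_0(x),P_1(h)\rrbracket$; (A4) $\llbracket P_0(x),P_2(y,z)\rrbracket-\llbracket P_0(y),P_2(x,z)\rrbracket+\llbracket P_0(z),P_2(x,y)\rrbracket-P_1\llbracket z,P_2(x,y)\rrbracket-P_2(\llbracket P_0(x),y\rrbracket,z)-P_2(y,\llbracket P_0(x),z\rrbracket)+P_2(x,\llbracket P_0(y),z\rrbracket)=l_3(P_0(x),P_0(y),P_0(z))-P_1l_3(P_0(x),P_0(y),z)$. A $2$-term averaging $L_\infty$-algebra is a $2$-term $L_\infty$-algebra with a homotopy averaging operator, written $(\mathfrak{g}_1\xrightarrow{d}\mathfrak{g}_0,\llbracket\,,\,\rrbracket,l_3,P_0,P_1,P_2)$. It is skeletal if $d=0$.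
   Formalization: With P_2 skew but θ arbitrary, the evident assignment θ = P_2 is not onto; it is proved bijective onto triples with θ skew, and onto all triples if P_2 is only bilinear; between the classes as literally defined only an abstract bijection, by cardinality, is shown. *)

theory Defs
  imports Complex_Main
begin

section \<open>Multilinear maps\<close>

definition bilinear_map ::
  "('k::field \<Rightarrow> 'a::ab_group_add \<Rightarrow> 'a) \<Rightarrow> ('k \<Rightarrow> 'b::ab_group_add \<Rightarrow> 'b) \<Rightarrow>
   ('k \<Rightarrow> 'c::ab_group_add \<Rightarrow> 'c) \<Rightarrow> ('a \<Rightarrow> 'b \<Rightarrow> 'c) \<Rightarrow> bool" where
  "bilinear_map sa sb sc f \<longleftrightarrow>
     (\<forall>x. Vector_Spaces.linear sb sc (\<lambda>y. f x y)) \<and>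
     (\<forall>y. Vector_Spaces.linear sa sc (\<lambda>x. f x y))"

definition trilinear_map ::
  "('k::field \<Rightarrow> 'a::ab_group_add \<Rightarrow> 'a) \<Rightarrow> ('k \<Rightarrow> 'b::ab_group_add \<Rightarrow> 'b) \<Rightarrow>
   ('a \<Rightarrow> 'a \<Rightarrow> 'a \<Rightarrow> 'b) \<Rightarrow> bool" where
  "trilinear_map sa sb f \<longleftrightarrow>
     (\<forall>x y. Vector_Spaces.linear sa sb (\<lambda>z. f x y z)) \<and>
     (\<forall>x z. Vector_Spaces.linear sa sb (\<lambda>y. f x y z)) \<and>
     (\<forall>y z. Vector_Spaces.linear sa sb (\<lambda>x. f x y z))"

definition skew_symmetric2 :: "('a \<Rightarrow> 'a \<Rightarrow> 'b::ab_group_add) \<Rightarrow> bool" where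
  "skew_symmetric2 f \<longleftrightarrow> (\<forall>x y. f x y = - f y x)"

definition skew_symmetric3 :: "('a \<Rightarrow> 'a \<Rightarrow> 'a \<Rightarrow> 'b::ab_group_add) \<Rightarrow> bool" where
  "skew_symmetric3 f \<longleftrightarrow> (\<forall>x y z. f x y z = - f y x z \<and> f x y z = - f x z y)"

text \<open>
  An element of \<open>Hom(\<g>\<^sup>\<otimes>\<^sup>n, V)\<close> is an \<open>n\<close>-linear function of argument lists of
  length \<open>n\<close>. It takes the value 0 on lists of any other length, so that distinct functions are
  distinct multilinear maps.
\<close>

definition Hom_tensor ::
  "('k::field \<Rightarrow> 'a::ab_group_add \<Rightarrow> 'a) \<Rightarrow> ('k \<Rightarrow> 'b::ab_group_add \<Rightarrow> 'b) \<Rightarrow>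
   nat \<Rightarrow> ('a list \<Rightarrow> 'b) set" where
  "Hom_tensor sa sb n =
     {f. (\<forall>xs ys. length xs + length ys + 1 = n \<longrightarrow>
            Vector_Spaces.linear sa sb (\<lambda>x. f (xs @ x # ys))) \<and>
         (\<forall>xs. length xs \<noteq> n \<longrightarrow> f xs = 0)}"

text \<open>\<open>Hom(\<And>\<^sup>n \<g>, V)\<close> consists of the alternating maps.\<close>

definition Hom_wedge ::
  "('k::field \<Rightarrow> 'a::ab_group_add \<Rightarrow> 'a) \<Rightarrow> ('k \<Rightarrow> 'b::ab_group_add \<Rightarrow> 'b) \<Rightarrow>
   nat \<Rightarrow> ('a list \<Rightarrow> 'b) set" where
  "Hom_wedge sa sb n =
     {f \<in> Hom_tensor sa sb n. \<forall>xs. length xs = n \<and> \<not> distinct xs \<longrightarrow> f xs = 0}"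


section \<open>Averaging Lie algebras and their representations\<close>

locale lie_algebra = vector_space scale
  for scale :: "'k::field_char_0 \<Rightarrow> 'a::ab_group_add \<Rightarrow> 'a" +
  fixes br :: "'a \<Rightarrow> 'a \<Rightarrow> 'a"
  assumes br_bilinear: "bilinear_map scale scale scale br"
    and br_alternating: "br x x = 0"
    and br_jacobi: "br x (br y z) + br y (br z x) + br z (br x y) = 0"

locale averaging_lie_algebra = lie_algebra scale br
  for scale :: "'k::field_char_0 \<Rightarrow> 'a::ab_group_add \<Rightarrow> 'a" and br :: "'a \<Rightarrow> 'a \<Rightarrow> 'a" +
  fixes P :: "'a \<Rightarrow> 'a"
  assumes P_linear: "Vector_Spaces.linear scale scale P"
    and P_averaging: "br (P x) (P y) = P (br (P x) y)"

locale averaging_representation = averaging_lie_algebra s0 br P + V: vector_space s1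
  for s0 :: "'k::field_char_0 \<Rightarrow> 'a::ab_group_add \<Rightarrow> 'a" and br :: "'a \<Rightarrow> 'a \<Rightarrow> 'a"
    and P :: "'a \<Rightarrow> 'a" and s1 :: "'k \<Rightarrow> 'b::ab_group_add \<Rightarrow> 'b" +
  fixes \<psi> :: "'a \<Rightarrow> 'b \<Rightarrow> 'b" and Q :: "'b \<Rightarrow> 'b"
  assumes \<psi>_bilinear: "bilinear_map s0 s1 s1 \<psi>"
    and \<psi>_bracket: "\<psi> (br x y) v = \<psi> x (\<psi> y v) - \<psi> y (\<psi> x v)"
    and Q_linear: "Vector_Spaces.linear s1 s1 Q"
    and \<psi>_Q_left: "\<psi> (P x) (Q v) = Q (\<psi> (P x) v)"
    and \<psi>_Q_right: "Q (\<psi> (P x) v) = Q (\<psi> x (Q v))"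


section \<open>Cohomology of averaging Lie algebras\<close>

text \<open>
  The arguments \<open>x\<^sub>1, \<dots>, x\<^sub>n\<close> are the list entries \<open>xs ! 0, \<dots>, xs ! (n - 1)\<close>, so
  the exponents of the signs below are shifted accordingly.
\<close>

definition omit :: "nat \<Rightarrow> 'a list \<Rightarrow> 'a list" where
  "omit i xs = take i xs @ drop (Suc i) xs"

definition CE_coboundary ::
  "('k::field_char_0 \<Rightarrow> 'b::ab_group_add \<Rightarrow> 'b) \<Rightarrow> ('a \<Rightarrow> 'a \<Rightarrow> 'a) \<Rightarrow> ('a \<Rightarrow> 'b \<Rightarrow> 'b) \<Rightarrow>
   nat \<Rightarrow> ('a list \<Rightarrow> 'b) \<Rightarrow> ('a list \<Rightarrow> 'b)" where
  "CE_coboundary s1 br \<psi> n f xs =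
     (if length xs = Suc n then
        (\<Sum>i<Suc n. s1 ((-1) ^ i) (\<psi> (xs ! i) (f (omit i xs)))) +
        (\<Sum>j<Suc n. \<Sum>i<j. s1 ((-1) ^ (i + j))
           (f (br (xs ! i) (xs ! j) # omit i (omit j xs))))
      else 0)"

text \<open>\<open>Leib_coboundary s1 br P \<psi> Q n\<close> maps \<open>Hom(\<g>\<^sup>\<otimes>\<^sup>n\<^sup>-\<^sup>1, V)\<close> to \<open>Hom(\<g>\<^sup>\<otimes>\<^sup>n, V)\<close>; it is
  the map written with upper index \<open>n - 1\<close>.\<close>

definition Leib_coboundary ::
  "('k::field_char_0 \<Rightarrow> 'b::ab_group_add \<Rightarrow> 'b) \<Rightarrow> ('a \<Rightarrow> 'a \<Rightarrow> 'a) \<Rightarrow> ('a \<Rightarrow> 'a) \<Rightarrow>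
   ('a \<Rightarrow> 'b \<Rightarrow> 'b) \<Rightarrow> ('b \<Rightarrow> 'b) \<Rightarrow> nat \<Rightarrow> ('a list \<Rightarrow> 'b) \<Rightarrow> ('a list \<Rightarrow> 'b)" where
  "Leib_coboundary s1 br P \<psi> Q n \<theta> xs =
     (if length xs = n then
        (\<Sum>i<n - 1. s1 ((-1) ^ i) (\<psi> (P (xs ! i)) (\<theta> (omit i xs)))) +
        s1 ((-1) ^ (n + 1)) (\<psi> (P (last xs)) (\<theta> (butlast xs))) +
        s1 ((-1) ^ n) (Q (\<psi> (last xs) (\<theta> (butlast xs)))) +
        (\<Sum>j<n. \<Sum>i<j. s1 ((-1) ^ (i + 1)) (\<theta> (omit i (xs[j := br (P (xs ! i)) (xs ! j)]))))
      else 0)"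

text \<open>For \<open>n = 1\<close> there is no second component, which is encoded by \<open>\<theta> = 0\<close>.\<close>

definition ALie_cochains ::
  "('k::field_char_0 \<Rightarrow> 'a::ab_group_add \<Rightarrow> 'a) \<Rightarrow> ('k \<Rightarrow> 'b::ab_group_add \<Rightarrow> 'b) \<Rightarrow>
   nat \<Rightarrow> (('a list \<Rightarrow> 'b) \<times> ('a list \<Rightarrow> 'b)) set" where
  "ALie_cochains s0 s1 n =
     (if n = 0 then {(\<lambda>_. 0, \<lambda>_. 0)}
      else if n = 1 then Hom_tensor s0 s1 1 \<times> {\<lambda>_. 0}
      else Hom_wedge s0 s1 n \<times> Hom_tensor s0 s1 (n - 1))"

definition ALie_coboundary ::
  "('k::field_char_0 \<Rightarrow> 'b::ab_group_add \<Rightarrow> 'b) \<Rightarrow> ('a \<Rightarrow> 'a \<Rightarrow> 'a) \<Rightarrow> ('a \<Rightarrow> 'a) \<Rightarrow>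
   ('a \<Rightarrow> 'b \<Rightarrow> 'b) \<Rightarrow> ('b \<Rightarrow> 'b) \<Rightarrow> nat \<Rightarrow>
   ('a list \<Rightarrow> 'b) \<times> ('a list \<Rightarrow> 'b) \<Rightarrow> ('a list \<Rightarrow> 'b) \<times> ('a list \<Rightarrow> 'b)" where
  "ALie_coboundary s1 br P \<psi> Q n c =
     (if n = 0 then (\<lambda>_. 0, \<lambda>_. 0)
      else
       (CE_coboundary s1 br \<psi> n (fst c),
        \<lambda>xs. if length xs = n then
               (if n = 1 then 0 else Leib_coboundary s1 br P \<psi> Q n (snd c) xs) +
               s1 ((-1) ^ n) (fst c (map P xs)) -
               s1 ((-1) ^ n) (Q (fst c (map P (butlast xs) @ [last xs])))
             else 0))"

definition ALie_cocycles ::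
  "('k::field_char_0 \<Rightarrow> 'a::ab_group_add \<Rightarrow> 'a) \<Rightarrow> ('k \<Rightarrow> 'b::ab_group_add \<Rightarrow> 'b) \<Rightarrow>
   ('a \<Rightarrow> 'a \<Rightarrow> 'a) \<Rightarrow> ('a \<Rightarrow> 'a) \<Rightarrow> ('a \<Rightarrow> 'b \<Rightarrow> 'b) \<Rightarrow> ('b \<Rightarrow> 'b) \<Rightarrow> nat \<Rightarrow>
   (('a list \<Rightarrow> 'b) \<times> ('a list \<Rightarrow> 'b)) set" where
  "ALie_cocycles s0 s1 br P \<psi> Q n =
     {c \<in> ALie_cochains s0 s1 n. ALie_coboundary s1 br P \<psi> Q n c = (\<lambda>_. 0, \<lambda>_. 0)}"

record ('a, 'b) alie_triple =
  lie_bracket :: "'a \<Rightarrow> 'a \<Rightarrow> 'a"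
  lie_op :: "'a \<Rightarrow> 'a"
  rep_act :: "'a \<Rightarrow> 'b \<Rightarrow> 'b"
  rep_op :: "'b \<Rightarrow> 'b"
  cochain :: "('a list \<Rightarrow> 'b) \<times> ('a list \<Rightarrow> 'b)"

definition cocycle_triples ::
  "('k::field_char_0 \<Rightarrow> 'a::ab_group_add \<Rightarrow> 'a) \<Rightarrow> ('k \<Rightarrow> 'b::ab_group_add \<Rightarrow> 'b) \<Rightarrow>
   ('a, 'b) alie_triple set" where
  "cocycle_triples s0 s1 =
     {T. averaging_representation s0 (lie_bracket T) (lie_op T) s1 (rep_act T) (rep_op T) \<and>
         cochain T \<in> ALie_cocycles s0 s1 (lie_bracket T) (lie_op T) (rep_act T) (rep_op T) 3}"


section \<open>2-term averaging L-infinity algebras\<close>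

text \<open>
  The bracket has a component for each pair of degrees: \<open>b00\<close>, \<open>b01\<close> and \<open>b10\<close>. The component
  on \<open>\<g>\<^sub>1 \<times> \<g>\<^sub>1\<close> has values in \<open>\<g>\<^sub>2 = 0\<close>; it carries no data, and axiom (L3), which says that
  it vanishes, holds automatically.
\<close>

locale two_term_Linf = G0: vector_space s0 + G1: vector_space s1
  for s0 :: "'k::field_char_0 \<Rightarrow> 'a::ab_group_add \<Rightarrow> 'a"
    and s1 :: "'k \<Rightarrow> 'b::ab_group_add \<Rightarrow> 'b" +
  fixes d :: "'b \<Rightarrow> 'a"
    and b00 :: "'a \<Rightarrow> 'a \<Rightarrow> 'a" and b01 :: "'a \<Rightarrow> 'b \<Rightarrow> 'b" and b10 :: "'b \<Rightarrow> 'a \<Rightarrow> 'b"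
    and l3 :: "'a \<Rightarrow> 'a \<Rightarrow> 'a \<Rightarrow> 'b"
  assumes d_linear: "Vector_Spaces.linear s1 s0 d"
    and b00_bilinear: "bilinear_map s0 s0 s0 b00"
    and b01_bilinear: "bilinear_map s0 s1 s1 b01"
    and b10_bilinear: "bilinear_map s1 s0 s1 b10"
    and l3_trilinear: "trilinear_map s0 s1 l3"
    and l3_skew: "skew_symmetric3 l3"
    and L1: "b00 x y = - b00 y x"
    and L2: "b01 x h = - b10 h x"
    and L4: "d (b01 x h) = b00 x (d h)"
    and L5: "b01 (d h) k = b10 h (d k)"
    and L6: "d (l3 x y z) = b00 x (b00 y z) + b00 y (b00 z x) + b00 z (b00 x y)"
    and L7: "l3 x y (d h) = b01 x (b01 y h) + b01 y (b10 h x) + b10 h (b00 x y)"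
    and L8: "b01 w (l3 x y z) - b01 x (l3 w y z) + b01 y (l3 w x z) - b01 z (l3 w x y) =
             l3 (b00 w x) y z - l3 (b00 w y) x z + l3 (b00 w z) x y
             + l3 (b00 x y) w z - l3 (b00 x z) w y + l3 (b00 y z) w x"

text \<open>
  The axioms of a homotopy averaging operator other than skew-symmetry of \<open>P2\<close>. The two notions
  are kept apart because the component \<open>\<theta>\<close> of a 3-cochain is an arbitrary bilinear map.
\<close>

locale bilinear_homotopy_averaging_operator = two_term_Linf s0 s1 d b00 b01 b10 l3
  for s0 :: "'k::field_char_0 \<Rightarrow> 'a::ab_group_add \<Rightarrow> 'a"
    and s1 :: "'k \<Rightarrow> 'b::ab_group_add \<Rightarrow> 'b"
    and d :: "'b \<Rightarrow> 'a"
    and b00 :: "'a \<Rightarrow> 'a \<Rightarrow> 'a" and b01 :: "'a \<Rightarrow> 'b \<Rightarrow> 'b" and b10 :: "'b \<Rightarrow> 'a \<Rightarrow> 'b"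
    and l3 :: "'a \<Rightarrow> 'a \<Rightarrow> 'a \<Rightarrow> 'b" +
  fixes P0 :: "'a \<Rightarrow> 'a" and P1 :: "'b \<Rightarrow> 'b" and P2 :: "'a \<Rightarrow> 'a \<Rightarrow> 'b"
  assumes P0_linear: "Vector_Spaces.linear s0 s0 P0"
    and P1_linear: "Vector_Spaces.linear s1 s1 P1"
    and P2_bilinear: "bilinear_map s0 s0 s1 P2"
    and A1: "P0 \<circ> d = d \<circ> P1"
    and A2: "d (P2 x y) = P0 (b00 (P0 x) y) - b00 (P0 x) (P0 y)"
    and A3_left: "P2 x (d h) = P1 (b01 (P0 x) h) - b01 (P0 x) (P1 h)"
    and A3_right: "P1 (b01 (P0 x) h) - b01 (P0 x) (P1 h) = P1 (b01 x (P1 h)) - b01 (P0 x) (P1 h)"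
    and A4: "b01 (P0 x) (P2 y z) - b01 (P0 y) (P2 x z) + b01 (P0 z) (P2 x y)
             - P1 (b01 z (P2 x y)) - P2 (b00 (P0 x) y) z - P2 y (b00 (P0 x) z)
             + P2 x (b00 (P0 y) z) =
             l3 (P0 x) (P0 y) (P0 z) - P1 (l3 (P0 x) (P0 y) z)"

locale homotopy_averaging_operator =
  bilinear_homotopy_averaging_operator s0 s1 d b00 b01 b10 l3 P0 P1 P2
  for s0 :: "'k::field_char_0 \<Rightarrow> 'a::ab_group_add \<Rightarrow> 'a"
    and s1 :: "'k \<Rightarrow> 'b::ab_group_add \<Rightarrow> 'b"
    and d :: "'b \<Rightarrow> 'a"
    and b00 :: "'a \<Rightarrow> 'a \<Rightarrow> 'a" and b01 :: "'a \<Rightarrow> 'b \<Rightarrow> 'b" and b10 :: "'b \<Rightarrow> 'a \<Rightarrow> 'b"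
    and l3 :: "'a \<Rightarrow> 'a \<Rightarrow> 'a \<Rightarrow> 'b"
    and P0 :: "'a \<Rightarrow> 'a" and P1 :: "'b \<Rightarrow> 'b" and P2 :: "'a \<Rightarrow> 'a \<Rightarrow> 'b" +
  assumes P2_skew: "skew_symmetric2 P2"

record ('a, 'b) two_term =
  diff :: "'b \<Rightarrow> 'a"
  br00 :: "'a \<Rightarrow> 'a \<Rightarrow> 'a"
  br01 :: "'a \<Rightarrow> 'b \<Rightarrow> 'b"
  br10 :: "'b \<Rightarrow> 'a \<Rightarrow> 'b"
  ell3 :: "'a \<Rightarrow> 'a \<Rightarrow> 'a \<Rightarrow> 'b"
  op0 :: "'a \<Rightarrow> 'a"
  op1 :: "'b \<Rightarrow> 'b"
  op2 :: "'a \<Rightarrow> 'a \<Rightarrow> 'b"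

definition averaging_Linf_algebras ::
  "('k::field_char_0 \<Rightarrow> 'a::ab_group_add \<Rightarrow> 'a) \<Rightarrow> ('k \<Rightarrow> 'b::ab_group_add \<Rightarrow> 'b) \<Rightarrow>
   ('a, 'b) two_term set" where
  "averaging_Linf_algebras s0 s1 =
     {S. homotopy_averaging_operator s0 s1 (diff S) (br00 S) (br01 S) (br10 S) (ell3 S)
           (op0 S) (op1 S) (op2 S)}"

definition bilinear_averaging_Linf_algebras ::
  "('k::field_char_0 \<Rightarrow> 'a::ab_group_add \<Rightarrow> 'a) \<Rightarrow> ('k \<Rightarrow> 'b::ab_group_add \<Rightarrow> 'b) \<Rightarrow>
   ('a, 'b) two_term set" where
  "bilinear_averaging_Linf_algebras s0 s1 =
     {S. bilinear_homotopy_averaging_operator s0 s1 (diff S) (br00 S) (br01 S) (br10 S) (ell3 S)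
           (op0 S) (op1 S) (op2 S)}"

definition skeletal :: "('a::zero, 'b) two_term \<Rightarrow> bool" where
  "skeletal S \<longleftrightarrow> diff S = (\<lambda>_. 0)"


section \<open>The canonical assignment\<close>

text \<open>
  \<open>\<g> = \<g>\<^sub>0\<close>, \<open>P = P\<^sub>0\<close>, \<open>V = \<g>\<^sub>1\<close>, \<open>\<psi>\<^sub>x h = [x, h]\<close>, \<open>Q = P\<^sub>1\<close>, \<open>f = l\<^sub>3\<close>, \<open>\<theta> = P\<^sub>2\<close>.
  If \<open>P\<^sub>2\<close> is skew-symmetric then so is \<open>\<theta>\<close>, but not every 3-cocycle has skew-symmetric \<open>\<theta>\<close>:
  if \<open>\<g>\<close> and \<open>V\<close> are the field and the bracket, \<open>P\<close>, \<open>\<psi>\<close> and \<open>Q\<close> are zero, then \<open>f = 0\<close>,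
  \<open>\<theta>(x, y) = x y\<close> is a 3-cocycle.
\<close>

definition triple_of :: "('a, 'b::zero) two_term \<Rightarrow> ('a, 'b) alie_triple" where
  "triple_of S =
     \<lparr> lie_bracket = br00 S, lie_op = op0 S, rep_act = br01 S, rep_op = op1 S,
       cochain =
         (\<lambda>xs. if length xs = 3 then ell3 S (xs ! 0) (xs ! 1) (xs ! 2) else 0,
          \<lambda>xs. if length xs = 2 then op2 S (xs ! 0) (xs ! 1) else 0) \<rparr>"

end

theory Submission
  imports Defs "HOL-Library.Equipollence"
begin

text \<open>
  Let \<open>d = 0\<close>. Then (L1) and (L6) say that the bracket on \<open>\<g>\<^sub>0\<close> is a Lie bracket, (L2) and (L7) that
  \<open>\<psi>\<^sub>x h = [x, h]\<close> is a representation and that the bracket \<open>[h, x]\<close> is determined by it, (A2) that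
  \<open>P\<^sub>0\<close> is averaging, and the two halves of (A3) are the two compatibility conditions between
  \<open>\<psi>\<close> and \<open>Q = P\<^sub>1\<close>. What is left, (L8) and (A4), are the two components of the equation
  \<open>\<delta>(l\<^sub>3, P\<^sub>2) = 0\<close> (lemma \<open>in_ALie_cocycles_3_iff\<close>). In characteristic zero a skew-symmetric
  trilinear map is the same thing as an alternating one, so \<open>triple_of\<close> is a bijection once \<open>P\<^sub>2\<close> may
  be any bilinear map, and it restricts to one between skew-symmetric \<open>P\<^sub>2\<close> and skew-symmetric \<open>\<theta>\<close>.

  A bijection from the algebras with skew-symmetric \<open>P\<^sub>2\<close> onto all triples has to be of a different
  nature, since \<open>\<theta>\<close> is arbitrary; it comes from counting. The algebras with skew-symmetric \<open>P\<^sub>2\<close>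
  are among those with bilinear \<open>P\<^sub>2\<close>, so by Schroeder-Bernstein an injection in the other direction
  suffices. If one of the spaces is zero, then every bilinear \<open>P\<^sub>2\<close> is zero and the two
  classes agree. Otherwise both spaces are infinite, because the field is. Let \<open>I\<close> be a basis of the
  space \<open>W\<close> of larger dimension among \<open>\<g>\<^sub>0\<close> and \<open>\<g>\<^sub>1\<close>. The set \<open>M\<close> of functions \<open>I \<rightarrow> W\<close> is in bijection
  with \<open>End(W)\<close> and satisfies \<open>|M\<^sup>I| = |M|\<close>. A multilinear map is determined by its values on basis
  vectors, so each of the structure maps ranges over a set of cardinality at most \<open>|M|\<close>
  (lemma \<open>bilinear_skeletal_lepoll\<close>). Conversely every endomorphism of \<open>\<g>\<^sub>0\<close> or of \<open>\<g>\<^sub>1\<close> is the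
  operator \<open>P\<^sub>0\<close> or \<open>P\<^sub>1\<close> of an algebra in which the brackets, \<open>l\<^sub>3\<close> and \<open>P\<^sub>2\<close> vanish, so there are at
  least \<open>|M|\<close> algebras with skew-symmetric \<open>P\<^sub>2\<close>.
\<close>

section \<open>Skew-symmetric and alternating maps\<close>

lemma double_eq_0_imp_eq_0:
  fixes s :: "'k::field_char_0 \<Rightarrow> 'a::ab_group_add \<Rightarrow> 'a"
  assumes "vector_space s" and "(v::'a) + v = 0"
  shows "v = 0"
proof -
  interpret vector_space s by fact
  have "s 2 v = 0"
    using assms(2) scale_left_distrib[of 1 1 v] by simp
  then show ?thesis by simp
qed

lemma alternating_iff_skew_symmetric2:
  fixes sb :: "'k::field_char_0 \<Rightarrow> 'b::ab_group_add \<Rightarrow> 'b"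
  assumes "bilinear_map sa sa sb b"
  shows "(\<forall>x. b x x = 0) \<longleftrightarrow> skew_symmetric2 b"
proof -
  have vs: "vector_space sb"
    and add: "b (x + y) z = b x z + b y z" "b x (y + z) = b x y + b x z" for x y z
    using assms by (auto simp: bilinear_map_def Vector_Spaces.linear_iff)
  show ?thesis
  proof
    assume alt: "\<forall>x. b x x = 0"
    have "b x y + b y x = 0" for x y
    proof -
      have "b x y + b y x = (b x x + b y x) + (b x y + b y y)"
        using alt by (simp add: add.commute)
      also have "\<dots> = b (x + y) (x + y)" by (simp only: add)
      finally show ?thesis using alt by simp
    qed
    then show "skew_symmetric2 b"
      unfolding skew_symmetric2_def by (metis add_eq_0_iff2)
  next
    assume "skew_symmetric2 b"
    then show "\<forall>x. b x x = 0"
      unfolding skew_symmetric2_def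
      by (metis add.right_inverse double_eq_0_imp_eq_0[OF vs])
  qed
qed

lemma alternating_iff_skew_symmetric3:
  fixes sb :: "'k::field_char_0 \<Rightarrow> 'b::ab_group_add \<Rightarrow> 'b"
  assumes "trilinear_map sa sb f"
  shows "(\<forall>x y z. x = y \<or> x = z \<or> y = z \<longrightarrow> f x y z = 0) \<longleftrightarrow> skew_symmetric3 f"
proof -
  have "bilinear_map sa sa sb (\<lambda>x y. f x y z)" "bilinear_map sa sa sb (f z)" for z
    using assms by (auto simp: trilinear_map_def bilinear_map_def)
  note outer = this[THEN alternating_iff_skew_symmetric2]
  have "skew_symmetric3 f \<longleftrightarrow>
      (\<forall>z. skew_symmetric2 (\<lambda>x y. f x y z)) \<and> (\<forall>x. skew_symmetric2 (f x))"
    unfolding skew_symmetric3_def skew_symmetric2_def by blast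
  also have "\<dots> \<longleftrightarrow> (\<forall>x z. f x x z = 0) \<and> (\<forall>x y. f x y y = 0)"
    unfolding outer[symmetric] by blast
  also have "\<dots> \<longleftrightarrow> (\<forall>x y z. x = y \<or> x = z \<or> y = z \<longrightarrow> f x y z = 0)"
  proof
    assume *: "(\<forall>x z. f x x z = 0) \<and> (\<forall>x y. f x y y = 0)"
    then have "skew_symmetric2 (\<lambda>x y. f x y z)" for z
      unfolding outer[symmetric] by blast
    then have "f x y x = - f y x x" for x y
      unfolding skew_symmetric2_def by blast
    with * show "\<forall>x y z. x = y \<or> x = z \<or> y = z \<longrightarrow> f x y z = 0" by auto
  qed blast
  finally show ?thesis by blast
qed

section \<open>Cochains as functions of two or three arguments\<close>

text \<open>
  Cochains are functions of argument lists that vanish on lists of the wrong length. With the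
  two operators below a bilinear or trilinear map becomes such a function.
\<close>

definition on_pairs :: "('a \<Rightarrow> 'a \<Rightarrow> 'b::zero) \<Rightarrow> 'a list \<Rightarrow> 'b" where
  "on_pairs g = (\<lambda>xs. if length xs = 2 then g (xs ! 0) (xs ! 1) else 0)"

definition on_triples :: "('a \<Rightarrow> 'a \<Rightarrow> 'a \<Rightarrow> 'b::zero) \<Rightarrow> 'a list \<Rightarrow> 'b" where
  "on_triples g = (\<lambda>xs. if length xs = 3 then g (xs ! 0) (xs ! 1) (xs ! 2) else 0)"

lemma on_pairs_simps [simp]:
  "on_pairs g [x, y] = g x y" "length xs \<noteq> 2 \<Longrightarrow> on_pairs g xs = 0"
  by (simp_all add: on_pairs_def)

lemma on_triples_simps [simp]:
  "on_triples g [x, y, z] = g x y z" "length xs \<noteq> 3 \<Longrightarrow> on_triples g xs = 0"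
  by (simp_all add: on_triples_def numeral_eq_Suc)

lemma length_eq_2_iff: "length xs = 2 \<longleftrightarrow> (\<exists>x y. xs = [x, y])"
  by (auto simp: numeral_eq_Suc length_Suc_conv)

lemma length_eq_3_iff: "length xs = 3 \<longleftrightarrow> (\<exists>x y z. xs = [x, y, z])"
  by (auto simp: numeral_eq_Suc length_Suc_conv)

lemma length_eq_4_iff: "length xs = 4 \<longleftrightarrow> (\<exists>w x y z. xs = [w, x, y, z])"
  by (auto simp: numeral_eq_Suc length_Suc_conv)

lemma list_cases3:
  obtains "xs = []" | x where "xs = [x]" | x y where "xs = [x, y]"
    | x y z zs where "xs = x # y # z # zs"
  by (metis list.exhaust)

lemma on_pairs_in_Hom_tensor_iff:
  "on_pairs g \<in> Hom_tensor sa sb 2 \<longleftrightarrow> bilinear_map sa sa sb g"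
proof -
  have *: "length xs + length ys + 1 = 2 \<longleftrightarrow> (\<exists>x. xs = [x] \<and> ys = [] \<or> xs = [] \<and> ys = [x])"
    for xs ys :: "'a list"
    by (cases xs; cases ys) auto
  have cases: "(\<forall>xs ys. (\<exists>x. xs = [x] \<and> ys = [] \<or> xs = [] \<and> ys = [x]) \<longrightarrow> R xs ys) \<longleftrightarrow>
      (\<forall>x. R [x] []) \<and> (\<forall>y. R [] [y])" for R :: "'a list \<Rightarrow> 'a list \<Rightarrow> bool"
    by blast
  show ?thesis
    unfolding Hom_tensor_def bilinear_map_def * cases by simp
qed

lemma on_triples_in_Hom_tensor_iff:
  "on_triples g \<in> Hom_tensor sa sb 3 \<longleftrightarrow> trilinear_map sa sb g"
proof -
  have *: "length xs + length ys + 1 = 3 \<longleftrightarrow>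
      (\<exists>x y. xs = [x, y] \<and> ys = [] \<or> xs = [x] \<and> ys = [y] \<or> xs = [] \<and> ys = [x, y])"
    for xs ys :: "'a list"
    by (cases xs rule: list_cases3; cases ys rule: list_cases3) auto
  have cases: "(\<forall>xs ys. (\<exists>x y. xs = [x, y] \<and> ys = [] \<or> xs = [x] \<and> ys = [y] \<or> xs = [] \<and> ys = [x, y])
        \<longrightarrow> R xs ys) \<longleftrightarrow>
      (\<forall>x y. R [x, y] []) \<and> (\<forall>x y. R [x] [y]) \<and> (\<forall>x y. R [] [x, y])"
    for R :: "'a list \<Rightarrow> 'a list \<Rightarrow> bool"
    by blast
  show ?thesis
    unfolding Hom_tensor_def trilinear_map_def * cases by simp
qed

text \<open>
  A list of length three has a repetition exactly if two of its three entries agree, so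
  membership in \<open>Hom(\<And>\<^sup>3 \<g>, V)\<close> says that the map is alternating.
\<close>

lemma on_triples_in_Hom_wedge_iff:
  fixes sb :: "'k::field_char_0 \<Rightarrow> 'b::ab_group_add \<Rightarrow> 'b"
  shows "on_triples g \<in> Hom_wedge sa sb 3 \<longleftrightarrow> trilinear_map sa sb g \<and> skew_symmetric3 g"
proof -
  have "(\<forall>xs. length xs = 3 \<and> \<not> distinct xs \<longrightarrow> on_triples g xs = 0) \<longleftrightarrow>
      (\<forall>x y z. x = y \<or> x = z \<or> y = z \<longrightarrow> g x y z = 0)"
    unfolding length_eq_3_iff by fastforce
  then show ?thesis
    using alternating_iff_skew_symmetric3[of sa sb g]
    unfolding Hom_wedge_def mem_Collect_eq on_triples_in_Hom_tensor_iff by blast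
qed

text \<open>
  A cochain is recovered from its values on lists of the right length because it is 0 on all others.
\<close>

lemma Hom_tensor_2_eq_on_pairs:
  assumes "f \<in> Hom_tensor sa sb 2"
  shows "f = on_pairs (\<lambda>x y. f [x, y])"
proof
  fix xs
  show "f xs = on_pairs (\<lambda>x y. f [x, y]) xs"
  proof (cases "length xs = 2")
    case True
    then show ?thesis by (auto simp: length_eq_2_iff)
  next
    case False
    then show ?thesis using assms by (simp add: Hom_tensor_def)
  qed
qed

lemma Hom_tensor_3_eq_on_triples:
  assumes "f \<in> Hom_tensor sa sb 3"
  shows "f = on_triples (\<lambda>x y z. f [x, y, z])"
proof
  fix xs
  show "f xs = on_triples (\<lambda>x y z. f [x, y, z]) xs"
  proof (cases "length xs = 3")
    case True
    then show ?thesis by (auto simp: length_eq_3_iff)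
  next
    case False
    then show ?thesis using assms by (simp add: Hom_tensor_def)
  qed
qed

section \<open>The 3-cocycle condition\<close>

text \<open>
  The first bracket is the left side of (L8) and the second its right side.
\<close>

lemma CE_coboundary_3:
  assumes "vector_space s1"
  shows "CE_coboundary s1 br \<psi> 3 (on_triples l) [w, x, y, z] =
    (\<psi> w (l x y z) - \<psi> x (l w y z) + \<psi> y (l w x z) - \<psi> z (l w x y)) -
    (l (br w x) y z - l (br w y) x z + l (br w z) x y
     + l (br x y) w z - l (br x z) w y + l (br y z) w x)"
proof -
  interpret vector_space s1 by fact
  show ?thesis
    by (simp add: CE_coboundary_def omit_def numeral_eq_Suc)
qed

text \<open>
  This is the left side of (A4), for \<open>P\<^sub>2 = t\<close>.
\<close>

lemma Leib_coboundary_3: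
  assumes "vector_space s1"
  shows "Leib_coboundary s1 br P \<psi> Q 3 (on_pairs t) [x, y, z] =
    \<psi> (P x) (t y z) - \<psi> (P y) (t x z) + \<psi> (P z) (t x y) - Q (\<psi> z (t x y))
    - t (br (P x) y) z - t y (br (P x) z) + t x (br (P y) z)"
proof -
  interpret vector_space s1 by fact
  show ?thesis
    by (simp add: Leib_coboundary_def omit_def numeral_eq_Suc)
qed

text \<open>
  For \<open>n = 3\<close> the sign \<open>(-1)\<^sup>n\<close> moves the two terms in \<open>f\<close> of the coboundary to the other side of the
  equation, so that the cocycle condition becomes (L8) together with (A4).
\<close>

lemma in_ALie_cocycles_3_iff:
  fixes s1 :: "'k::field_char_0 \<Rightarrow> 'b::ab_group_add \<Rightarrow> 'b"
  assumes "vector_space s1"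
  shows "(on_triples l, on_pairs t) \<in> ALie_cocycles s0 s1 br P \<psi> Q 3 \<longleftrightarrow>
    trilinear_map s0 s1 l \<and> skew_symmetric3 l \<and> bilinear_map s0 s0 s1 t \<and>
    (\<forall>w x y z. \<psi> w (l x y z) - \<psi> x (l w y z) + \<psi> y (l w x z) - \<psi> z (l w x y) =
      l (br w x) y z - l (br w y) x z + l (br w z) x y
      + l (br x y) w z - l (br x z) w y + l (br y z) w x) \<and>
    (\<forall>x y z. \<psi> (P x) (t y z) - \<psi> (P y) (t x z) + \<psi> (P z) (t x y) - Q (\<psi> z (t x y))
      - t (br (P x) y) z - t y (br (P x) z) + t x (br (P y) z) =
      l (P x) (P y) (P z) - Q (l (P x) (P y) z))"
proof -
  interpret vector_space s1 by fact
  have CE: "CE_coboundary s1 br \<psi> 3 (on_triples l) = (\<lambda>_. 0) \<longleftrightarrow>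
      (\<forall>w x y z. CE_coboundary s1 br \<psi> 3 (on_triples l) [w, x, y, z] = 0)" (is "?L \<longleftrightarrow> ?R")
  proof
    assume ?R
    then have "CE_coboundary s1 br \<psi> 3 (on_triples l) xs = 0" for xs
      by (cases "length xs = 4") (auto simp: length_eq_4_iff CE_coboundary_def)
    then show ?L by blast
  qed simp
  let ?D = "snd (ALie_coboundary s1 br P \<psi> Q 3 (on_triples l, on_pairs t))"
  have D: "?D = (\<lambda>_. 0) \<longleftrightarrow> (\<forall>x y z. ?D [x, y, z] = 0)" (is "?L \<longleftrightarrow> ?R")
  proof
    assume ?R
    then have "?D xs = 0" for xs
      by (cases "length xs = 3") (auto simp: length_eq_3_iff ALie_coboundary_def)
    then show ?L by blast
  qed simp
  have D3: "?D [x, y, z] =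
    \<psi> (P x) (t y z) - \<psi> (P y) (t x z) + \<psi> (P z) (t x y) - Q (\<psi> z (t x y))
    - t (br (P x) y) z - t y (br (P x) z) + t x (br (P y) z)
    - (l (P x) (P y) (P z) - Q (l (P x) (P y) z))" for x y z
    by (simp add: ALie_coboundary_def Leib_coboundary_3[OF assms] algebra_simps)
  have "(on_triples l, on_pairs t) \<in> ALie_cocycles s0 s1 br P \<psi> Q 3 \<longleftrightarrow>
      on_triples l \<in> Hom_wedge s0 s1 3 \<and> on_pairs t \<in> Hom_tensor s0 s1 2 \<and>
      CE_coboundary s1 br \<psi> 3 (on_triples l) = (\<lambda>_. 0) \<and> ?D = (\<lambda>_. 0)"
    by (auto simp: ALie_cocycles_def ALie_cochains_def ALie_coboundary_def)
  then show ?thesis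
    unfolding CE D D3 CE_coboundary_3[OF assms] right_minus_eq
      on_triples_in_Hom_wedge_iff on_pairs_in_Hom_tensor_iff
    by blast
qed

section \<open>Skeletal algebras and cocycle triples\<close>

lemmas linear_at_0 = module_hom.zero[OF module_hom_linearI]
  and linear_at_uminus = module_hom.neg[OF module_hom_linearI]

text \<open>
  The axioms match one by one, apart from three points. (L1) gives \<open>[x, x] = 0\<close> only because 2 is
  invertible. (L7) is the representation property after \<open>[h, x]\<close> has been replaced by \<open>-[x, h]\<close>.
  The left sides of (L7) and (A3) vanish because \<open>l\<^sub>3(x, y, 0) = 0\<close> and \<open>P\<^sub>2(x, 0) = 0\<close>, so that
  neither condition involves \<open>l\<^sub>3\<close> or \<open>P\<^sub>2\<close>.
\<close>

lemma skeletal_axioms_iff: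
  fixes s0 :: "'k::field_char_0 \<Rightarrow> 'a::ab_group_add \<Rightarrow> 'a"
    and s1 :: "'k \<Rightarrow> 'b::ab_group_add \<Rightarrow> 'b"
  assumes "vector_space s0" and "vector_space s1"
  shows "bilinear_homotopy_averaging_operator s0 s1 (\<lambda>_. 0) br \<psi> (\<lambda>h x. - \<psi> x h) l P Q t \<longleftrightarrow>
    averaging_representation s0 br P s1 \<psi> Q \<and>
    (on_triples l, on_pairs t) \<in> ALie_cocycles s0 s1 br P \<psi> Q 3"
  (is "?A \<longleftrightarrow> ?B \<and> ?C")
proof
  interpret g: vector_space s0 by fact
  interpret V: vector_space s1 by fact
  assume ?A
  then interpret bilinear_homotopy_averaging_operator s0 s1 "\<lambda>_. 0" br \<psi> "\<lambda>h x. - \<psi> x h" l P Q t .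
  have neg: "\<psi> x (- h) = - \<psi> x h" for x h
    using b01_bilinear unfolding bilinear_map_def by (blast intro: linear_at_uminus)
  have ?B
  proof (intro averaging_representation.intro averaging_representation_axioms.intro
      averaging_lie_algebra.intro averaging_lie_algebra_axioms.intro
      lie_algebra.intro lie_algebra_axioms.intro assms)
    show "br x x = 0" for x
      using b00_bilinear L1 alternating_iff_skew_symmetric2 by (metis skew_symmetric2_def)
    show "br x (br y z) + br y (br z x) + br z (br x y) = 0" for x y z
      using L6[of x y z] by simp
    show "\<psi> (br x y) v = \<psi> x (\<psi> y v) - \<psi> y (\<psi> x v)" for x y v
    proof -
      have "l x y 0 = 0"
        using l3_trilinear unfolding trilinear_map_def by (blast intro: linear_at_0)
      then show ?thesis using L7[of x y v] by (simp add: neg algebra_simps)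
    qed
    have t0: "t x 0 = 0" for x
      using P2_bilinear unfolding bilinear_map_def by (blast intro: linear_at_0)
    show "\<psi> (P x) (Q v) = Q (\<psi> (P x) v)" for x v
      using A3_left[of x v] by (simp add: t0)
    show "Q (\<psi> (P x) v) = Q (\<psi> x (Q v))" for x v
      using A3_right[of x v] by simp
  qed (use b00_bilinear P0_linear b01_bilinear P1_linear A2 in auto)
  moreover have ?C
    unfolding in_ALie_cocycles_3_iff[OF assms(2)]
    using l3_trilinear l3_skew P2_bilinear L8 A4 by blast
  ultimately show "?B \<and> ?C" ..
next
  assume *: "?B \<and> ?C"
  then interpret averaging_representation s0 br P s1 \<psi> Q by blast
  from * have c: "trilinear_map s0 s1 l" "skew_symmetric3 l" "bilinear_map s0 s0 s1 t"
    "\<And>w x y z. \<psi> w (l x y z) - \<psi> x (l w y z) + \<psi> y (l w x z) - \<psi> z (l w x y) =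
      l (br w x) y z - l (br w y) x z + l (br w z) x y
      + l (br x y) w z - l (br x z) w y + l (br y z) w x"
    "\<And>x y z. \<psi> (P x) (t y z) - \<psi> (P y) (t x z) + \<psi> (P z) (t x y) - Q (\<psi> z (t x y))
      - t (br (P x) y) z - t y (br (P x) z) + t x (br (P y) z) =
      l (P x) (P y) (P z) - Q (l (P x) (P y) z)"
    unfolding in_ALie_cocycles_3_iff[OF assms(2)] by blast+
  have skew: "br x y = - br y x" for x y
    using br_bilinear br_alternating alternating_iff_skew_symmetric2
    by (metis skew_symmetric2_def)
  have lin: "module_hom s1 s1 (\<psi> x)" "module_hom s0 s1 (\<lambda>x. \<psi> x v)"
    "module_hom s0 s0 (br x)" "module_hom s0 s0 P" "module_hom s1 s1 Q"
    "module_hom s0 s1 (\<lambda>z. l x y z)" "module_hom s0 s1 (t x)" for x y v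
    using \<psi>_bilinear br_bilinear c P_linear Q_linear
    by (auto simp: bilinear_map_def trilinear_map_def module_hom_iff_linear)
  note zero = lin[THEN module_hom.zero] and neg = lin[THEN module_hom.neg]
  show ?A
  proof (intro bilinear_homotopy_averaging_operator.intro
      bilinear_homotopy_averaging_operator_axioms.intro
      two_term_Linf.intro two_term_Linf_axioms.intro assms)
    show "bilinear_map s1 s0 s1 (\<lambda>h x. - \<psi> x h)"
      using \<psi>_bilinear by (auto simp: bilinear_map_def Vector_Spaces.linear_iff)
    show "Vector_Spaces.linear s1 s0 (\<lambda>_. 0)"
      using assms by (simp add: Vector_Spaces.linear_iff)
    show "br x y = - br y x" for x y by (rule skew)
    show "l x y 0 = \<psi> x (\<psi> y h) + \<psi> y (- \<psi> x h) + - \<psi> (br x y) h" for x y h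
      by (simp add: zero neg \<psi>_bracket)
    show "P \<circ> (\<lambda>_. 0) = (\<lambda>_. 0) \<circ> Q" by (auto simp: zero)
    show "t x 0 = Q (\<psi> (P x) h) - \<psi> (P x) (Q h)" for x h
      by (simp add: zero \<psi>_Q_left)
    show "Q (\<psi> (P x) h) - \<psi> (P x) (Q h) = Q (\<psi> x (Q h)) - \<psi> (P x) (Q h)" for x h
      by (simp add: \<psi>_Q_right)
  qed (use br_bilinear \<psi>_bilinear c P_linear Q_linear br_jacobi P_averaging zero in auto)
qed

lemma in_bilinear_skeletal_iff:
  fixes s0 :: "'k::field_char_0 \<Rightarrow> 'a::ab_group_add \<Rightarrow> 'a"
    and s1 :: "'k \<Rightarrow> 'b::ab_group_add \<Rightarrow> 'b"
  assumes "vector_space s0" and "vector_space s1"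
  shows "S \<in> bilinear_averaging_Linf_algebras s0 s1 \<and> skeletal S \<longleftrightarrow>
    diff S = (\<lambda>_. 0) \<and> br10 S = (\<lambda>h x. - br01 S x h) \<and> triple_of S \<in> cocycle_triples s0 s1"
proof -
  have "br10 S = (\<lambda>h x. - br01 S x h)" if "S \<in> bilinear_averaging_Linf_algebras s0 s1"
  proof -
    interpret bilinear_homotopy_averaging_operator s0 s1 "diff S" "br00 S" "br01 S" "br10 S"
        "ell3 S" "op0 S" "op1 S" "op2 S"
      using that by (simp add: bilinear_averaging_Linf_algebras_def)
    show ?thesis by (intro ext) (simp add: L2)
  qed
  moreover have "triple_of S \<in> cocycle_triples s0 s1 \<longleftrightarrow>
      averaging_representation s0 (br00 S) (op0 S) s1 (br01 S) (op1 S) \<and>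
      (on_triples (ell3 S), on_pairs (op2 S)) \<in>
        ALie_cocycles s0 s1 (br00 S) (op0 S) (br01 S) (op1 S) 3"
    by (simp add: cocycle_triples_def triple_of_def on_pairs_def on_triples_def)
  ultimately show ?thesis
    using skeletal_axioms_iff[OF assms]
    by (auto simp: bilinear_averaging_Linf_algebras_def skeletal_def)
qed

text \<open>
  The inverse map puts back \<open>d = 0\<close> and \<open>[h, x] = -\<psi>\<^sub>x h\<close>, the two pieces of data that
  \<open>triple_of\<close> forgets.
\<close>

lemma bij_betw_triple_of:
  fixes s0 :: "'k::field_char_0 \<Rightarrow> 'a::ab_group_add \<Rightarrow> 'a"
    and s1 :: "'k \<Rightarrow> 'b::ab_group_add \<Rightarrow> 'b"
  assumes "vector_space s0" and "vector_space s1"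
  shows "bij_betw triple_of {S \<in> bilinear_averaging_Linf_algebras s0 s1. skeletal S}
    (cocycle_triples s0 s1)"
proof -
  let ?inv = "\<lambda>T. \<lparr> diff = (\<lambda>_. 0), br00 = lie_bracket T, br01 = rep_act T,
      br10 = (\<lambda>h x. - rep_act T x h), ell3 = (\<lambda>x y z. fst (cochain T) [x, y, z]),
      op0 = lie_op T, op1 = rep_op T, op2 = (\<lambda>x y. snd (cochain T) [x, y]) \<rparr>"
  have left: "?inv (triple_of S) = S"
    if "S \<in> bilinear_averaging_Linf_algebras s0 s1" "skeletal S" for S
    using that in_bilinear_skeletal_iff[OF assms, of S] by (simp add: triple_of_def)
  have right: "triple_of (?inv T) = T" if "T \<in> cocycle_triples s0 s1" for T
  proof -
    have "cochain T \<in> Hom_tensor s0 s1 3 \<times> Hom_tensor s0 s1 2"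
      using that by (auto simp: cocycle_triples_def ALie_cocycles_def ALie_cochains_def Hom_wedge_def)
    then have c: "cochain T = (on_triples (\<lambda>x y z. fst (cochain T) [x, y, z]),
        on_pairs (\<lambda>x y. snd (cochain T) [x, y]))"
      using Hom_tensor_3_eq_on_triples Hom_tensor_2_eq_on_pairs
      by (metis mem_Times_iff prod.collapse)
    have "triple_of (?inv T) = \<lparr> lie_bracket = lie_bracket T, lie_op = lie_op T,
        rep_act = rep_act T, rep_op = rep_op T,
        cochain = (on_triples (\<lambda>x y z. fst (cochain T) [x, y, z]),
          on_pairs (\<lambda>x y. snd (cochain T) [x, y])) \<rparr>"
      by (simp add: triple_of_def on_pairs_def on_triples_def cong: if_cong)
    also have "\<dots> = T"
      by (simp flip: c)
    finally show ?thesis .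
  qed
  show ?thesis
  proof (rule bij_betw_byWitness[where f' = ?inv])
    show "?inv ` cocycle_triples s0 s1 \<subseteq> {S \<in> bilinear_averaging_Linf_algebras s0 s1. skeletal S}"
      using right by (auto simp: in_bilinear_skeletal_iff[OF assms])
    show "triple_of ` {S \<in> bilinear_averaging_Linf_algebras s0 s1. skeletal S} \<subseteq> cocycle_triples s0 s1"
      by (auto simp: in_bilinear_skeletal_iff[OF assms])
  qed (use left right in auto)
qed

lemma in_averaging_iff:
  "S \<in> averaging_Linf_algebras s0 s1 \<longleftrightarrow>
    S \<in> bilinear_averaging_Linf_algebras s0 s1 \<and> skew_symmetric2 (op2 S)"
  by (simp add: averaging_Linf_algebras_def bilinear_averaging_Linf_algebras_def
      homotopy_averaging_operator_def homotopy_averaging_operator_axioms_def)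

lemma bij_betw_triple_of_skew:
  fixes s0 :: "'k::field_char_0 \<Rightarrow> 'a::ab_group_add \<Rightarrow> 'a"
    and s1 :: "'k \<Rightarrow> 'b::ab_group_add \<Rightarrow> 'b"
  assumes "vector_space s0" and "vector_space s1"
  shows "bij_betw triple_of {S \<in> averaging_Linf_algebras s0 s1. skeletal S}
    {T \<in> cocycle_triples s0 s1. skew_symmetric2 (\<lambda>x y. snd (cochain T) [x, y])}"
proof -
  have op2: "(\<lambda>x y. snd (cochain (triple_of S)) [x, y]) = op2 S" for S :: "('a, 'b) two_term"
    by (simp add: triple_of_def)
  have eq: "{S \<in> averaging_Linf_algebras s0 s1. skeletal S} =
      {S \<in> {S \<in> bilinear_averaging_Linf_algebras s0 s1. skeletal S}. skew_symmetric2 (op2 S)}"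
    by (auto simp: in_averaging_iff)
  show ?thesis
    unfolding eq by (rule bij_betw_Collect[OF bij_betw_triple_of[OF assms]]) (simp add: op2)
qed

section \<open>Cardinalities of powers\<close>

lemma infinite_times_lepoll:
  assumes "infinite M"
  shows "M \<times> M \<lesssim> M"
  using card_of_Times_same_infinite[OF assms]
  by (metis eqpoll_iff_card_of_ordIso eqpoll_imp_lepoll)

lemma finite_power_lepoll:
  assumes "infinite M" "finite F"
  shows "F \<rightarrow>\<^sub>E M \<lesssim> M"
  using assms(2)
proof induction
  case empty
  from assms(1) obtain m where "m \<in> M" by fastforce
  then show ?case by (auto simp: lepoll_def)
next
  case (insert a F)
  have "insert a F \<rightarrow>\<^sub>E M \<lesssim> M \<times> (F \<rightarrow>\<^sub>E M)"
  proof -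
    have "insert a F \<rightarrow>\<^sub>E M = (\<lambda>(y, g). g(a := y)) ` (M \<times> (F \<rightarrow>\<^sub>E M))"
      by (simp add: PiE_insert_eq)
    then show ?thesis by (simp add: image_lepoll)
  qed
  also have "\<dots> \<lesssim> M \<times> M"
    by (intro times_lepoll_mono insert.IH lepoll_refl)
  also have "\<dots> \<lesssim> M"
    by (rule infinite_times_lepoll[OF assms(1)])
  finally show ?case .
qed

lemma curry_lepoll: "I \<rightarrow>\<^sub>E (J \<rightarrow>\<^sub>E W) \<lesssim> I \<times> J \<rightarrow>\<^sub>E W"
proof -
  let ?u = "\<lambda>h. \<lambda>p \<in> I \<times> J. h (fst p) (snd p)"
  have "inj_on ?u (I \<rightarrow>\<^sub>E (J \<rightarrow>\<^sub>E W))"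
  proof (rule inj_onI)
    fix h k assume h: "h \<in> I \<rightarrow>\<^sub>E (J \<rightarrow>\<^sub>E W)" and k: "k \<in> I \<rightarrow>\<^sub>E (J \<rightarrow>\<^sub>E W)" and eq: "?u h = ?u k"
    show "h = k"
    proof (rule PiE_ext[OF h k])
      fix i assume i: "i \<in> I"
      show "h i = k i"
      proof (rule PiE_ext[of _ J "\<lambda>_. W"])
        fix j assume "j \<in> J"
        then show "h i j = k i j" using fun_cong[OF eq, of "(i, j)"] i by simp
      qed (use h k i in auto)
    qed
  qed
  moreover have "?u ` (I \<rightarrow>\<^sub>E (J \<rightarrow>\<^sub>E W)) \<subseteq> I \<times> J \<rightarrow>\<^sub>E W"
  proof (intro image_subsetI restrict_PiE_iff[THEN iffD2] ballI)
    fix h p assume h: "h \<in> I \<rightarrow>\<^sub>E (J \<rightarrow>\<^sub>E W)" and p: "p \<in> I \<times> J"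
    have "h (fst p) \<in> J \<rightarrow>\<^sub>E W" by (rule PiE_mem[OF h]) (use p in auto)
    then show "h (fst p) (snd p) \<in> W" by (rule PiE_mem) (use p in auto)
  qed
  ultimately show ?thesis unfolding lepoll_def by blast
qed

lemma base_lepoll_power:
  assumes "I \<noteq> {}"
  shows "W \<lesssim> I \<rightarrow>\<^sub>E W"
proof -
  have "inj_on (\<lambda>w. \<lambda>i \<in> I. w) W"
    using assms by (auto simp: inj_on_def fun_eq_iff restrict_def)
  then show ?thesis unfolding lepoll_def by (intro exI[of _ "\<lambda>w. \<lambda>i \<in> I. w"]) auto
qed

lemma infinite_lepoll: "infinite A \<Longrightarrow> A \<lesssim> B \<Longrightarrow> infinite B"
  by (meson infinite_le_lepoll lepoll_trans)

text \<open>
  For infinite \<open>I\<close> this is \<open>|I \<times> I| = |I|\<close> in the exponent. For finite \<open>I\<close> it is a statement about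
  the infinite base, as finite powers do not increase the cardinality of an infinite set.
\<close>

lemma power_of_power_lepoll:
  assumes "infinite W" "I \<noteq> {}"
  shows "I \<rightarrow>\<^sub>E (I \<rightarrow>\<^sub>E W) \<lesssim> I \<rightarrow>\<^sub>E W"
proof (cases "finite I")
  case True
  have "infinite (I \<rightarrow>\<^sub>E W)"
    using infinite_lepoll[OF assms(1) base_lepoll_power[OF assms(2)]] .
  then show ?thesis using True by (rule finite_power_lepoll)
next
  case False
  have "W \<noteq> {}" using assms(1) by auto
  have "I \<rightarrow>\<^sub>E (I \<rightarrow>\<^sub>E W) \<lesssim> I \<times> I \<rightarrow>\<^sub>E W" by (rule curry_lepoll)
  also have "\<dots> \<lesssim> I \<rightarrow>\<^sub>E W"
    by (rule lepoll_funcset_left[OF \<open>W \<noteq> {}\<close> infinite_times_lepoll[OF False]])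
  finally show ?thesis .
qed

text \<open>
  The condition \<open>I \<rightarrow>\<^sub>E M \<lesssim> M\<close> makes bounds by \<open>M\<close> pass from a set \<open>N\<close> of values to
  a set of \<open>N\<close>-valued functions. Multilinear maps are handled by applying this once for each argument.
\<close>

lemma lepoll_if_determined_on:
  assumes "inj_on (\<lambda>f. restrict f B) F" and "\<And>f x. f \<in> F \<Longrightarrow> x \<in> B \<Longrightarrow> f x \<in> N"
    and "N \<lesssim> M" and "B \<lesssim> I" and "I \<rightarrow>\<^sub>E M \<lesssim> M" and "M \<noteq> {}"
  shows "F \<lesssim> M"
proof -
  have "F \<lesssim> B \<rightarrow>\<^sub>E N"
    unfolding lepoll_def by (rule exI[of _ "\<lambda>f. restrict f B"]) (use assms in auto)
  also have "\<dots> \<lesssim> B \<rightarrow>\<^sub>E M" by (rule lepoll_funcset_right[OF assms(3)])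
  also have "\<dots> \<lesssim> I \<rightarrow>\<^sub>E M" by (rule lepoll_funcset_left[OF assms(6,4)])
  also note assms(5)
  finally show ?thesis .
qed

section \<open>Cardinalities of sets of multilinear maps\<close>

text \<open>
  The values \<open>f x\<close> may themselves be functions. The type of such functions carries no vector space
  structure, so linearity in \<open>x\<close> is expressed through a separating family of evaluations
  \<open>e y\<close>; for a linear map this is the identity, for a bilinear map evaluation at the second argument.
\<close>

lemma maps_linear_in_first_argument_lepoll:
  fixes F :: "('u::ab_group_add \<Rightarrow> 'v) set" and e :: "'y \<Rightarrow> 'v \<Rightarrow> 'w::ab_group_add"
  assumes "vector_space s" and span: "module.span s B = UNIV"
    and lin: "\<And>f y. f \<in> F \<Longrightarrow> Vector_Spaces.linear s s' (\<lambda>x. e y (f x))"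
    and separating: "\<And>p q. (\<And>y. e y p = e y q) \<Longrightarrow> p = q"
    and "\<And>f x. f \<in> F \<Longrightarrow> f x \<in> N"
    and "N \<lesssim> M" "B \<lesssim> I" "I \<rightarrow>\<^sub>E M \<lesssim> M" "M \<noteq> {}"
  shows "F \<lesssim> M"
proof (rule lepoll_if_determined_on)
  show "inj_on (\<lambda>f. restrict f B) F"
  proof (rule inj_onI)
    fix f g assume F: "f \<in> F" "g \<in> F" and eq: "restrict f B = restrict g B"
    have "e y (f x) = e y (g x)" for x y
    proof -
      interpret vector_space_pair s s'
        using lin[OF F(1)] by (simp add: Vector_Spaces.linear_iff vector_space_pair_def)
      show ?thesis
      proof (rule linear_eq_on[OF lin[OF F(1)] lin[OF F(2)]])
        show "x \<in> module.span s B" by (simp add: span)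
        show "e y (f b) = e y (g b)" if "b \<in> B" for b
          using fun_cong[OF eq, of b] that by simp
      qed
    qed
    then show "f = g" using separating by blast
  qed
qed (use assms in auto)

text \<open>
  Every function on a linearly independent set extends to a linear map.
\<close>

lemma power_lepoll_endomorphisms:
  fixes s :: "'k::field \<Rightarrow> 'a::ab_group_add \<Rightarrow> 'a"
  assumes "vector_space s" "\<not> module.dependent s B"
  shows "B \<rightarrow>\<^sub>E (UNIV :: 'a set) \<lesssim> {f. Vector_Spaces.linear s s f}"
proof -
  interpret vector_space s by fact
  interpret vector_space_pair s s by unfold_locales
  have "inj_on (construct B) (B \<rightarrow>\<^sub>E UNIV)"
  proof (rule inj_onI)
    fix f g assume f: "f \<in> B \<rightarrow>\<^sub>E (UNIV :: 'a set)" and g: "g \<in> B \<rightarrow>\<^sub>E (UNIV :: 'a set)"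
      and eq: "construct B f = construct B g"
    show "f = g"
      by (rule PiE_ext[OF f g]) (metis eq assms(2) construct_basis)
  qed
  then show ?thesis
    unfolding lepoll_def using linear_construct[OF assms(2)] by blast
qed

text \<open>
  An injection of bases extends to an injective linear map.
\<close>

lemma space_lepoll_space:
  fixes s :: "'k::field \<Rightarrow> 'a::ab_group_add \<Rightarrow> 'a" and s' :: "'k \<Rightarrow> 'b::ab_group_add \<Rightarrow> 'b"
  assumes "vector_space s" "vector_space s'" "\<not> module.dependent s B" "module.span s B = UNIV"
    "\<not> module.dependent s' B'" "B \<lesssim> B'"
  shows "(UNIV :: 'a set) \<lesssim> (UNIV :: 'b set)"
proof -
  interpret V: vector_space s by fact
  interpret W: vector_space s' by fact
  interpret vector_space_pair s s' by unfold_locales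
  from assms(6) obtain j where j: "inj_on j B" "j ` B \<subseteq> B'" unfolding lepoll_def by blast
  let ?f = "construct B j"
  have eq: "?f b = j b" if "b \<in> B" for b using construct_basis[OF assms(3) that] .
  have "W.independent (?f ` B)"
    using W.independent_mono[OF assms(5) j(2)] eq by (metis image_cong)
  moreover have "inj_on ?f B" using j(1) eq by (metis inj_on_cong)
  ultimately have "inj_on ?f (V.span B)"
    by (rule linear_inj_on_span_independent_image[OF linear_construct[OF assms(3)]])
  then show ?thesis using assms(4) by (auto simp: lepoll_def)
qed

lemma infinite_vector_space:
  fixes s :: "'k::field_char_0 \<Rightarrow> 'a::ab_group_add \<Rightarrow> 'a"
  assumes "vector_space s" "(v::'a) \<noteq> 0"
  shows "infinite (UNIV :: 'a set)"
proof -
  interpret vector_space s by fact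
  have "inj (\<lambda>n::nat. s (of_nat n) v)"
    using assms(2) by (auto intro: injI)
  then show ?thesis by (metis finite_subset infinite_UNIV_nat finite_imageD subset_UNIV)
qed

lemma lepoll_total: "A \<lesssim> B \<or> B \<lesssim> A"
  by (metis card_of_ordLeq lepoll_def ordLeq_total card_of_Well_order)

section \<open>Counting skeletal algebras\<close>

text \<open>
  Six structure maps determine a skeletal algebra, since \<open>d = 0\<close> and \<open>[h, x] = -[x, h]\<close>. Each of them
  lies in a set bounded by \<open>M\<close>, and \<open>M \<times> M \<lesssim> M\<close>.
\<close>

lemma bilinear_skeletal_lepoll:
  fixes s0 :: "'k::field_char_0 \<Rightarrow> 'a::ab_group_add \<Rightarrow> 'a"
    and s1 :: "'k \<Rightarrow> 'b::ab_group_add \<Rightarrow> 'b"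
  assumes vs: "vector_space s0" "vector_space s1"
    and span: "module.span s0 B0 = UNIV" "module.span s1 B1 = UNIV"
    and BI: "B0 \<lesssim> I" "B1 \<lesssim> I"
    and UNIV_M: "(UNIV :: 'a set) \<lesssim> M" "(UNIV :: 'b set) \<lesssim> M"
    and M: "I \<rightarrow>\<^sub>E M \<lesssim> M" "infinite M"
  shows "{S \<in> bilinear_averaging_Linf_algebras s0 s1. skeletal S} \<lesssim> M" (is "?A \<lesssim> M")
proof -
  have ne: "M \<noteq> {}" using M(2) by auto
  note maps0 = maps_linear_in_first_argument_lepoll[OF vs(1) span(1) _ _ _ _ BI(1) M(1) ne]
    and maps1 = maps_linear_in_first_argument_lepoll[OF vs(2) span(2) _ _ _ _ BI(2) M(1) ne]
  have lin00: "{f. Vector_Spaces.linear s0 s0 f} \<lesssim> M"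
    by (rule maps0[where e = "\<lambda>_::unit. \<lambda>p. p" and s' = s0, OF _ _ _ UNIV_M(1)]) auto
  have lin01: "{f. Vector_Spaces.linear s0 s1 f} \<lesssim> M"
    by (rule maps0[where e = "\<lambda>_::unit. \<lambda>p. p" and s' = s1, OF _ _ _ UNIV_M(2)]) auto
  have lin11: "{f. Vector_Spaces.linear s1 s1 f} \<lesssim> M"
    by (rule maps1[where e = "\<lambda>_::unit. \<lambda>p. p" and s' = s1, OF _ _ _ UNIV_M(2)]) auto
  have bil000: "{b. bilinear_map s0 s0 s0 b} \<lesssim> M"
    by (rule maps0[where e = "\<lambda>y p. p y" and s' = s0, OF _ _ _ lin00]) (auto simp: bilinear_map_def)
  have bil011: "{b. bilinear_map s0 s1 s1 b} \<lesssim> M"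
    by (rule maps0[where e = "\<lambda>y p. p y" and s' = s1, OF _ _ _ lin11]) (auto simp: bilinear_map_def)
  have bil001: "{b. bilinear_map s0 s0 s1 b} \<lesssim> M"
    by (rule maps0[where e = "\<lambda>y p. p y" and s' = s1, OF _ _ _ lin01]) (auto simp: bilinear_map_def)
  have tri: "{l. trilinear_map s0 s1 l} \<lesssim> M"
    by (rule maps0[where e = "\<lambda>(y, z) p. p y z" and s' = s1, OF _ _ _ bil001])
      (auto simp: trilinear_map_def bilinear_map_def)
  let ?data = "\<lambda>S :: ('a, 'b) two_term. (br00 S, op0 S, br01 S, op1 S, ell3 S, op2 S)"
  let ?maps = "{b. bilinear_map s0 s0 s0 b} \<times> {f. Vector_Spaces.linear s0 s0 f} \<times>
    {b. bilinear_map s0 s1 s1 b} \<times> {f. Vector_Spaces.linear s1 s1 f} \<times>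
    {l. trilinear_map s0 s1 l} \<times> {b. bilinear_map s0 s0 s1 b}"
  have "inj_on ?data ?A"
  proof (rule inj_onI)
    fix S T assume "S \<in> ?A" "T \<in> ?A" "?data S = ?data T"
    then show "S = T"
      by (cases S; cases T) (auto simp: in_bilinear_skeletal_iff[OF vs])
  qed
  moreover have "?data ` ?A \<subseteq> ?maps"
    by (auto simp: bilinear_averaging_Linf_algebras_def bilinear_homotopy_averaging_operator_def
        bilinear_homotopy_averaging_operator_axioms_def two_term_Linf_def two_term_Linf_axioms_def)
  ultimately have "?A \<lesssim> ?maps"
    unfolding lepoll_def by blast
  also have "\<dots> \<lesssim> M \<times> M \<times> M \<times> M \<times> M \<times> M"
    by (intro times_lepoll_mono lin00 lin11 bil000 bil011 bil001 tri)
  also have "\<dots> \<lesssim> M"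
  proof -
    have absorb: "M \<times> X \<lesssim> M" if "X \<lesssim> M" for X
      by (rule lepoll_trans[OF times_lepoll_mono[OF lepoll_refl that] infinite_times_lepoll[OF M(2)]])
    show ?thesis by (intro absorb lepoll_refl)
  qed
  finally show ?thesis .
qed

text \<open>
  Every axiom holds here because all its terms vanish; this gives the lower bound on the number of
  algebras with skew-symmetric \<open>P\<^sub>2\<close>.
\<close>

lemma abelian_algebra_in_skeletal:
  assumes vs: "vector_space s0" "vector_space s1"
    and "Vector_Spaces.linear s0 s0 P" "Vector_Spaces.linear s1 s1 Q"
  shows "\<lparr> diff = (\<lambda>_. 0), br00 = (\<lambda>_ _. 0), br01 = (\<lambda>_ _. 0), br10 = (\<lambda>_ _. 0),
      ell3 = (\<lambda>_ _ _. 0), op0 = P, op1 = Q, op2 = (\<lambda>_ _. 0) \<rparr>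
    \<in> {S \<in> averaging_Linf_algebras s0 s1. skeletal S}"
proof -
  have zero: "Vector_Spaces.linear s1 s0 (\<lambda>_. 0)" "Vector_Spaces.linear s0 s1 (\<lambda>_. 0)"
    "Vector_Spaces.linear s0 s0 (\<lambda>_. 0)" "Vector_Spaces.linear s1 s1 (\<lambda>_. 0)"
    using vs by (auto simp: vector_space_pair_def intro: vector_space_pair.linear_zero)
  have "P 0 = 0" "Q 0 = 0" using assms(3,4)[THEN linear_at_0] .
  then show ?thesis
    using assms zero
    by (simp add: in_averaging_iff bilinear_averaging_Linf_algebras_def skeletal_def
        bilinear_homotopy_averaging_operator_def fun_eq_iff
        bilinear_homotopy_averaging_operator_axioms_def two_term_Linf_def two_term_Linf_axioms_def
        skew_symmetric2_def skew_symmetric3_def bilinear_map_def trilinear_map_def)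
qed

lemma endomorphisms_lepoll_skeletal:
  assumes vs: "vector_space s0" "vector_space s1"
  shows "{P. Vector_Spaces.linear s0 s0 P} \<lesssim> {S \<in> averaging_Linf_algebras s0 s1. skeletal S}"
    and "{Q. Vector_Spaces.linear s1 s1 Q} \<lesssim> {S \<in> averaging_Linf_algebras s0 s1. skeletal S}"
proof -
  let ?S = "\<lambda>P Q. \<lparr> diff = (\<lambda>_. 0), br00 = (\<lambda>_ _. 0), br01 = (\<lambda>_ _. 0), br10 = (\<lambda>_ _. 0),
      ell3 = (\<lambda>_ _ _. 0), op0 = P, op1 = Q, op2 = (\<lambda>_ _. 0) \<rparr>"
  have zero: "Vector_Spaces.linear s0 s0 (\<lambda>_. 0)" "Vector_Spaces.linear s1 s1 (\<lambda>_. 0)"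
    using vs by (auto simp: vector_space_pair_def intro: vector_space_pair.linear_zero)
  show "{P. Vector_Spaces.linear s0 s0 P} \<lesssim> {S \<in> averaging_Linf_algebras s0 s1. skeletal S}"
    unfolding lepoll_def
  proof (intro exI conjI)
    show "inj_on (\<lambda>P. ?S P (\<lambda>_. 0)) {P. Vector_Spaces.linear s0 s0 P}" by (simp add: inj_on_def)
    show "(\<lambda>P. ?S P (\<lambda>_. 0)) ` {P. Vector_Spaces.linear s0 s0 P}
        \<subseteq> {S \<in> averaging_Linf_algebras s0 s1. skeletal S}"
      using abelian_algebra_in_skeletal[OF vs _ zero(2)] by blast
  qed
  show "{Q. Vector_Spaces.linear s1 s1 Q} \<lesssim> {S \<in> averaging_Linf_algebras s0 s1. skeletal S}"
    unfolding lepoll_def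
  proof (intro exI conjI)
    show "inj_on (\<lambda>Q. ?S (\<lambda>_. 0) Q) {Q. Vector_Spaces.linear s1 s1 Q}" by (simp add: inj_on_def)
    show "(\<lambda>Q. ?S (\<lambda>_. 0) Q) ` {Q. Vector_Spaces.linear s1 s1 Q}
        \<subseteq> {S \<in> averaging_Linf_algebras s0 s1. skeletal S}"
      using abelian_algebra_in_skeletal[OF vs zero(1)] by blast
  qed
qed

text \<open>
  The bound \<open>M\<close> has to be matched by the endomorphisms of a single space. This works for the space of
  larger dimension: its basis and its underlying set dominate those of the other space.
\<close>

lemma bilinear_skeletal_lepoll_skeletal:
  fixes s0 :: "'k::field_char_0 \<Rightarrow> 'a::ab_group_add \<Rightarrow> 'a"
    and s1 :: "'k \<Rightarrow> 'b::ab_group_add \<Rightarrow> 'b"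
  assumes vs: "vector_space s0" "vector_space s1"
    and "(x0 :: 'a) \<noteq> 0" "(v0 :: 'b) \<noteq> 0"
  shows "{S \<in> bilinear_averaging_Linf_algebras s0 s1. skeletal S}
    \<lesssim> {S \<in> averaging_Linf_algebras s0 s1. skeletal S}" (is "?bil \<lesssim> ?skew")
proof -
  interpret g: vector_space s0 by fact
  interpret V: vector_space s1 by fact
  obtain B0 where B0: "g.independent B0" "g.span B0 = UNIV"
    by (rule g.basis_exists[of UNIV]) (simp add: top.extremum_unique that)
  obtain B1 where B1: "V.independent B1" "V.span B1 = UNIV"
    by (rule V.basis_exists[of UNIV]) (simp add: top.extremum_unique that)
  have ne: "B0 \<noteq> {}" "B1 \<noteq> {}"
    using B0(2) B1(2) assms(3,4) g.span_empty V.span_empty by (metis UNIV_I singletonD)+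
  note inf = infinite_vector_space[OF vs(1) assms(3)] infinite_vector_space[OF vs(2) assms(4)]
  consider "B1 \<lesssim> B0" | "B0 \<lesssim> B1"
    using lepoll_total by blast
  then show ?thesis
  proof cases
    case 1
    let ?M = "B0 \<rightarrow>\<^sub>E (UNIV :: 'a set)"
    have UM: "(UNIV :: 'a set) \<lesssim> ?M" by (rule base_lepoll_power[OF ne(1)])
    have "?bil \<lesssim> ?M"
    proof (rule bilinear_skeletal_lepoll[OF vs B0(2) B1(2) lepoll_refl 1 UM])
      show "(UNIV :: 'b set) \<lesssim> ?M"
        using space_lepoll_space[OF vs(2,1) B1 B0(1) 1] UM by (rule lepoll_trans)
      show "B0 \<rightarrow>\<^sub>E ?M \<lesssim> ?M" by (rule power_of_power_lepoll[OF inf(1) ne(1)])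
      show "infinite ?M" by (rule infinite_lepoll[OF inf(1) UM])
    qed
    also have "?M \<lesssim> {P. Vector_Spaces.linear s0 s0 P}"
      by (rule power_lepoll_endomorphisms[OF vs(1) B0(1)])
    also have "\<dots> \<lesssim> ?skew" by (rule endomorphisms_lepoll_skeletal(1)[OF vs])
    finally show ?thesis .
  next
    case 2
    let ?M = "B1 \<rightarrow>\<^sub>E (UNIV :: 'b set)"
    have UM: "(UNIV :: 'b set) \<lesssim> ?M" by (rule base_lepoll_power[OF ne(2)])
    have "?bil \<lesssim> ?M"
    proof (rule bilinear_skeletal_lepoll[OF vs B0(2) B1(2) 2 lepoll_refl _ UM])
      show "(UNIV :: 'a set) \<lesssim> ?M"
        using space_lepoll_space[OF vs B0 B1(1) 2] UM by (rule lepoll_trans)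
      show "B1 \<rightarrow>\<^sub>E ?M \<lesssim> ?M" by (rule power_of_power_lepoll[OF inf(2) ne(2)])
      show "infinite ?M" by (rule infinite_lepoll[OF inf(2) UM])
    qed
    also have "?M \<lesssim> {Q. Vector_Spaces.linear s1 s1 Q}"
      by (rule power_lepoll_endomorphisms[OF vs(2) B1(1)])
    also have "\<dots> \<lesssim> ?skew" by (rule endomorphisms_lepoll_skeletal(2)[OF vs])
    finally show ?thesis .
  qed
qed

text \<open>
  Between nonzero spaces the two sets dominate each other. If one of the spaces is zero, they are
  equal, because every bilinear map \<open>P\<^sub>2\<close> is zero.
\<close>

lemma skeletal_eqpoll_bilinear_skeletal:
  fixes s0 :: "'k::field_char_0 \<Rightarrow> 'a::ab_group_add \<Rightarrow> 'a"
    and s1 :: "'k \<Rightarrow> 'b::ab_group_add \<Rightarrow> 'b"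
  assumes vs: "vector_space s0" "vector_space s1"
  shows "{S \<in> averaging_Linf_algebras s0 s1. skeletal S}
    \<approx> {S \<in> bilinear_averaging_Linf_algebras s0 s1. skeletal S}" (is "?skew \<approx> ?bil")
proof (cases "\<exists>(x0 :: 'a) (v0 :: 'b). x0 \<noteq> 0 \<and> v0 \<noteq> 0")
  case True
  then obtain x0 :: 'a and v0 :: 'b where "x0 \<noteq> 0" "v0 \<noteq> 0" by blast
  then have "?bil \<lesssim> ?skew"
    by (rule bilinear_skeletal_lepoll_skeletal[OF vs])
  moreover have "?skew \<lesssim> ?bil"
    by (rule subset_imp_lepoll) (auto simp: in_averaging_iff)
  ultimately show ?thesis
    using lepoll_antisym by blast
next
  case False
  have "skew_symmetric2 (op2 S)" if "S \<in> bilinear_averaging_Linf_algebras s0 s1" for S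
  proof -
    interpret bilinear_homotopy_averaging_operator s0 s1 "diff S" "br00 S" "br01 S" "br10 S"
        "ell3 S" "op0 S" "op1 S" "op2 S"
      using that by (simp add: bilinear_averaging_Linf_algebras_def)
    have zero: "op2 S 0 y = 0" for y
      using P2_bilinear linear_at_0[of s0 s1 "\<lambda>x. op2 S x y"] by (simp add: bilinear_map_def)
    have "op2 S x y = 0" for x y
    proof (cases "x = 0")
      case True
      then show ?thesis by (simp add: zero)
    next
      case False
      then show ?thesis using \<open>\<not> (\<exists>(x0 :: 'a) (v0 :: 'b). x0 \<noteq> 0 \<and> v0 \<noteq> 0)\<close> by blast
    qed
    then show ?thesis by (simp add: skew_symmetric2_def)
  qed
  then have "?skew = ?bil" by (auto simp: in_averaging_iff)
  then show ?thesis by simp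
qed

theorem proposition3p4:
  fixes s0 :: "'k::field_char_0 \<Rightarrow> 'a::ab_group_add \<Rightarrow> 'a"
    and s1 :: "'k \<Rightarrow> 'b::ab_group_add \<Rightarrow> 'b"
  assumes "vector_space s0" and "vector_space s1"
  shows "(\<exists>\<Phi>. bij_betw \<Phi> {S \<in> averaging_Linf_algebras s0 s1. skeletal S} (cocycle_triples s0 s1)) \<and>
     bij_betw triple_of {S \<in> averaging_Linf_algebras s0 s1. skeletal S}
       {T \<in> cocycle_triples s0 s1. skew_symmetric2 (\<lambda>x y. snd (cochain T) [x, y])} \<and>
     bij_betw triple_of {S \<in> bilinear_averaging_Linf_algebras s0 s1. skeletal S}
       (cocycle_triples s0 s1)"
proof (intro conjI)
  show bil: "bij_betw triple_of {S \<in> bilinear_averaging_Linf_algebras s0 s1. skeletal S}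
      (cocycle_triples s0 s1)"
    by (rule bij_betw_triple_of[OF assms])
  show "bij_betw triple_of {S \<in> averaging_Linf_algebras s0 s1. skeletal S}
      {T \<in> cocycle_triples s0 s1. skew_symmetric2 (\<lambda>x y. snd (cochain T) [x, y])}"
    by (rule bij_betw_triple_of_skew[OF assms])
  show "\<exists>\<Phi>. bij_betw \<Phi> {S \<in> averaging_Linf_algebras s0 s1. skeletal S} (cocycle_triples s0 s1)"
    using skeletal_eqpoll_bilinear_skeletal[OF assms] bil unfolding eqpoll_def
    by (blast intro: bij_betw_trans)
qed

end
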